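(* Let $G=(V,E)$ be a finite graph with $n:=|V|$, let $d_v$ denote the degree of $v\in V$, let $\bar d:=\frac1n\sum_{v\in V}d_v$ be the average degree and $\delta:=\min_{v\in V}d_v$, with $\delta \ge 1$. Let $K\in\mathbb{N}$, $K\ge1$, and let $p=(p_v)_{v\in V}\in[0,1]^V$. Suppose that $\lambda_v=d_v/\bar d$ and $p_v\le\frac23K/d_v$ for all $v\in V$. If $X=(X^t)_{t\ge0}$ and $Y=(Y^t)_{t\ge0}$ are both realisations of the Markov chain $\mathsf{MCH}_\Omega(\lambda,p)$, then for all $t\ge0$ $$\max_{x,y\in\Omega}\bigl\|\mathbb{P}_x[X^t\in\cdot]-\mathbb{P}_y[Y^t\in\cdot]\bigr\|_{\mathsf{TV}}\le\min\bigl\{2n e^{-(\delta/\bar d)t/3},\,1\bigr\}.$$ In particular, $$t_{\mathrm{mix}}(\varepsilon)\le 3(\bar d/\delta)\log(2n/\varepsilon)\qquad\text{for all }\varepsilon\in(0,1).$$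
   Context: Graphs are finite, undirected, without loops or multiple edges, with non-empty vertex set. Write $[K]=\{1,\dots,K\}$ and $[K]_0=\{0,1,\dots,K\}$. State space: $\Omega:=\{\omega\in[K]_0^V : \omega \text{ is proper}\}$, where $\omega=(\omega_v)_{v\in V}$ is proper if $\omega_u\ne\omega_v$ whenever $\{u,v\}\in E$ and $\omega_u+\omega_v>0$. A vertex $v$ is active in $\omega$ if $\omega_v\neq 0$; colour $0$ means inactive. For $\lambda\in(0,\infty)^V$ and $p\in[0,1]^V$, the chain $\mathsf{MCH}_\Omega(\lambda,p)$ (multicoloured hardcore model) is the continuous-time Markov chain on $\Omega$ in which each vertex $v\in V$ is selected for update at rate $\lambda_v$, independently over the vertices. When $v$ is selected, toss a coin $C\sim\mathrm{Bern}(p_v)$ and independently draw a colour $k\sim\mathrm{Unif}([K])$. If $C=1$ and no neighbour of $v$ currently has colour $k$, then set $v$ to colour $k$; otherwise (if $C=0$ or some neighbour has colour $k$), set $v$ to colour $0$. Its equilibrium (invariant) distribution is denoted $\pi$. $\mathbb{P}_x$ denotes the law of the chain started from $x$. Total-variation distance between distributions $\mu,\pi$ on $\Omega$: $\|\mu-\pi\|_{\mathsf{TV}}:=\max_{A\subseteq\Omega}|\mu(A)-\pi(A)|$. Mixing time: $t_{\mathrm{mix}}(\varepsilon):=\inf\{t\ge0 : \max_{x\in\Omega}\|\mathbb{P}_x[X^t\in\cdot]-\pi\|_{\mathsf{TV}}\le\varepsilon\}$. *)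

theory Defs
  imports "HOL-Probability.Probability"
begin

definition simple_graph :: "'a set \<Rightarrow> 'a set set \<Rightarrow> bool" where
  "simple_graph V E \<longleftrightarrow> finite V \<and> V \<noteq> {} \<and> (\<forall>e\<in>E. e \<subseteq> V \<and> card e = 2)"

definition vertex_degree :: "'a set \<Rightarrow> 'a set set \<Rightarrow> 'a \<Rightarrow> nat" where
  "vertex_degree V E v = card {u \<in> V. {u, v} \<in> E}"

definition avg_degree :: "'a set \<Rightarrow> 'a set set \<Rightarrow> real" where
  "avg_degree V E = (\<Sum>v\<in>V. real (vertex_degree V E v)) / real (card V)"

definition min_degree :: "'a set \<Rightarrow> 'a set set \<Rightarrow> nat" where
  "min_degree V E = Min (vertex_degree V E ` V)"

text \<open>
  The semigroup \<open>e\<^sup>t\<^sup>L\<close> of a generator \<open>L\<close> acting on observables.  It is used only for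
  \<open>L\<close> bounded in the supremum norm, for which the series converges.
\<close>

definition semigroup_of :: "(('s \<Rightarrow> real) \<Rightarrow> 's \<Rightarrow> real) \<Rightarrow> real \<Rightarrow> ('s \<Rightarrow> real) \<Rightarrow> 's \<Rightarrow> real" where
  "semigroup_of L t f x = (\<Sum>k. t ^ k / fact k * (L ^^ k) f x)"

definition trans_prob :: "(('s \<Rightarrow> real) \<Rightarrow> 's \<Rightarrow> real) \<Rightarrow> real \<Rightarrow> 's \<Rightarrow> 's \<Rightarrow> real" where
  "trans_prob L t x y = semigroup_of L t (indicator {y}) x"

text \<open>
  Under \<open>M\<close>, the process \<open>X\<close> is a Markov chain on \<open>S\<close> with generator \<open>L\<close> started from \<open>x\<close>.
  The last clause is the Markov property with transition semigroup \<open>e\<^sup>t\<^sup>L\<close>: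
  \<open>s\<close> is the present and \<open>T\<close> a finite set of observation times up to and including \<open>s\<close>.
  It is multiplied out so that no conditioning on null events occurs.
\<close>

definition markov_chain ::
  "'s set \<Rightarrow> (('s \<Rightarrow> real) \<Rightarrow> 's \<Rightarrow> real) \<Rightarrow> 's \<Rightarrow> 'm measure \<Rightarrow> (real \<Rightarrow> 'm \<Rightarrow> 's) \<Rightarrow> bool" where
  "markov_chain S L x M X \<longleftrightarrow>
     prob_space M \<and>
     (\<forall>t\<ge>0. X t \<in> measurable M (count_space S)) \<and>
     (AE w in M. X 0 w = x) \<and>
     (\<forall>T s h z y. finite T \<and> s \<in> T \<and> T \<subseteq> {0..s} \<and> 0 \<le> h \<and> y \<in> S \<longrightarrow>
        measure M {w \<in> space M. (\<forall>r\<in>T. X r w = z r) \<and> X (s + h) w = y} =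
        measure M {w \<in> space M. \<forall>r\<in>T. X r w = z r} * trans_prob L h (z s) y)"

definition law_at :: "'s set \<Rightarrow> 'm measure \<Rightarrow> (real \<Rightarrow> 'm \<Rightarrow> 's) \<Rightarrow> real \<Rightarrow> 's measure" where
  "law_at S M X t = distr M (count_space S) (X t)"

definition equilibrium ::
  "'s set \<Rightarrow> (('s \<Rightarrow> real) \<Rightarrow> 's \<Rightarrow> real) \<Rightarrow> 's pmf \<Rightarrow> bool" where
  "equilibrium S L \<pi> \<longleftrightarrow> set_pmf \<pi> \<subseteq> S \<and>
     (\<forall>t\<ge>0. \<forall>y\<in>S. (\<Sum>x\<in>S. pmf \<pi> x * trans_prob L t x y) = pmf \<pi> y)"

definition tv_dist :: "'s set \<Rightarrow> 's measure \<Rightarrow> 's measure \<Rightarrow> real" where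
  "tv_dist S \<mu> \<nu> = Max ((\<lambda>A. \<bar>measure \<mu> A - measure \<nu> A\<bar>) ` Pow S)"

text \<open>\<open>P t x\<close> is the law at time \<open>t\<close> from \<open>x\<close>; extended reals make the infimum of the empty set \<open>\<infinity>\<close>.\<close>

definition mixing_time ::
  "'s set \<Rightarrow> (real \<Rightarrow> 's \<Rightarrow> 's measure) \<Rightarrow> 's pmf \<Rightarrow> real \<Rightarrow> ereal" where
  "mixing_time S P \<pi> \<epsilon> =
     Inf (ereal ` {t. 0 \<le> t \<and> Max ((\<lambda>x. tv_dist S (P t x) (measure_pmf \<pi>)) ` S) \<le> \<epsilon>})"

definition configs :: "'a set \<Rightarrow> 'a set set \<Rightarrow> nat \<Rightarrow> ('a \<Rightarrow> nat) set" where
  "configs V E K = {\<sigma> \<in> V \<rightarrow>\<^sub>E {0..K}.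
     \<forall>u\<in>V. \<forall>v\<in>V. {u, v} \<in> E \<and> \<sigma> u + \<sigma> v > 0 \<longrightarrow> \<sigma> u \<noteq> \<sigma> v}"

definition mch_update ::
  "'a set \<Rightarrow> 'a set set \<Rightarrow> nat \<Rightarrow> ('a \<Rightarrow> real) \<Rightarrow> 'a \<Rightarrow> ('a \<Rightarrow> nat) \<Rightarrow> ('a \<Rightarrow> nat) pmf" where
  "mch_update V E K p v \<sigma> =
     bind_pmf (bernoulli_pmf (p v)) (\<lambda>C.
     bind_pmf (pmf_of_set {1..K}) (\<lambda>k.
     return_pmf (\<sigma>(v := (if C \<and> (\<forall>u\<in>V. {u, v} \<in> E \<longrightarrow> \<sigma> u \<noteq> k) then k else 0)))))"

text \<open>
  Independent clocks of rate \<open>\<lambda>\<^sub>v\<close> superpose, so their generators add up.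
\<close>

definition mch_generator ::
  "'a set \<Rightarrow> 'a set set \<Rightarrow> nat \<Rightarrow> ('a \<Rightarrow> real) \<Rightarrow> ('a \<Rightarrow> real)
     \<Rightarrow> (('a \<Rightarrow> nat) \<Rightarrow> real) \<Rightarrow> ('a \<Rightarrow> nat) \<Rightarrow> real" where
  "mch_generator V E K lam p f \<sigma> =
     (\<Sum>v\<in>V. lam v * (measure_pmf.expectation (mch_update V E K p v \<sigma>) f - f \<sigma>))"

lemma mch_update_in_configs:
  assumes "K \<ge> 1" "simple_graph V E" "\<sigma> \<in> configs V E K" "v \<in> V"
  shows "set_pmf (mch_update V E K p v \<sigma>) \<subseteq> configs V E K"
proof
  fix \<eta> assume "\<eta> \<in> set_pmf (mch_update V E K p v \<sigma>)"
  moreover have "set_pmf (pmf_of_set {1..K}) = {1..K}"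
    using assms(1) by (intro set_pmf_of_set) auto
  ultimately obtain c where c: "\<eta> = \<sigma>(v := c)" "c \<le> K"
    and cc: "c = 0 \<or> (\<forall>u\<in>V. {u, v} \<in> E \<longrightarrow> \<sigma> u \<noteq> c)"
    unfolding mch_update_def by (fastforce split: if_splits)
  have nl: "{v, v} \<notin> E"
    using assms(2) by (auto simp: simple_graph_def)
  have ext: "\<eta> \<in> V \<rightarrow>\<^sub>E {0..K}"
    using assms(3,4) c by (auto simp: configs_def PiE_iff extensional_def)
  have "\<eta> u \<noteq> \<eta> u'"
    if u: "u \<in> V" "u' \<in> V" "{u, u'} \<in> E" and pos: "\<eta> u + \<eta> u' > 0" for u u'
  proof -
    have "{u', u} \<in> E" using u(3) by (simp add: insert_commute)
    then show ?thesis
      using u pos c cc nl assms(3) unfolding configs_def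
      by (cases "u = v"; cases "u' = v") auto
  qed
  with ext show "\<eta> \<in> configs V E K"
    by (auto simp: configs_def)
qed

end

theory Submission
  imports Defs
begin

text \<open>
  Path coupling, written dually for observables.  Two configurations are adjacent if one arises from
  the other by deactivating a single vertex \<open>w\<close>.  Under simultaneous updates of an adjacent pair the
  discrepancy at \<open>w\<close> disappears at rate \<open>lam w = d\<^sub>w / dbar\<close>, whereas each neighbour \<open>v\<close> of \<open>w\<close>
  becomes a second discrepancy at rate at most \<open>lam v * p v / K \<le> 2 / (3 * dbar)\<close>, since this requires
  drawing exactly the colour of \<open>w\<close>.  Hence the largest increment of an observable over adjacent pairs
  decays at rate \<open>d\<^sub>w / (3 * dbar) \<ge> \<delta> / (3 * dbar)\<close>, and any two configurations are joined through
  the empty one by at most \<open>2 * n\<close> adjacent steps.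
\<close>

section \<open>Semigroups of bounded jump operators\<close>

text \<open>The rate-weighted update operator is kept only as a linear map of sup-norm at most
  \<Lambda>. The same \<Lambda>, the total jump rate, is subtracted in \<open>gen\<close>, so norm
  growth and holding rate balance.\<close>

locale jump_operator =
  fixes A :: "('s \<Rightarrow> real) \<Rightarrow> 's \<Rightarrow> real" and \<Lambda> :: real
  assumes add: "A (\<lambda>x. f x + g x) = (\<lambda>x. A f x + A g x)"
    and scale: "A (\<lambda>x. a * f x) = (\<lambda>x. a * A f x)"
    and bound: "(\<And>x. \<bar>f x\<bar> \<le> B) \<Longrightarrow> \<bar>A f x\<bar> \<le> \<Lambda> * B"
begin

definition gen :: "('s \<Rightarrow> real) \<Rightarrow> 's \<Rightarrow> real" where
  "gen f x = A f x - \<Lambda> * f x"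

lemma A_sum: "finite I \<Longrightarrow> A (\<lambda>x. \<Sum>i\<in>I. f i x) = (\<lambda>x. \<Sum>i\<in>I. A (f i) x)"
proof (induction I rule: finite_induct)
  case empty
  show ?case using scale[of 0 "\<lambda>_. 0"] by simp
next
  case (insert i I)
  then show ?case by (simp add: add)
qed

lemma gen_sum: "finite I \<Longrightarrow> gen (\<lambda>x. \<Sum>i\<in>I. f i x) = (\<lambda>x. \<Sum>i\<in>I. gen (f i) x)"
  by (simp add: gen_def fun_eq_iff A_sum sum_subtractf sum_distrib_left)

lemma gen_pow_sum:
  "finite I \<Longrightarrow> (gen ^^ k) (\<lambda>x. \<Sum>i\<in>I. f i x) = (\<lambda>x. \<Sum>i\<in>I. (gen ^^ k) (f i) x)"
  by (induction k) (simp_all add: gen_sum)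

lemma A_pow_bound:
  assumes "\<And>x. \<bar>f x\<bar> \<le> B"
  shows "\<bar>(A ^^ k) f x\<bar> \<le> \<Lambda> ^ k * B"
proof (induction k arbitrary: x)
  case (Suc k)
  then show ?case using bound[of "(A ^^ k) f" "\<Lambda> ^ k * B" x] by (simp add: mult.assoc)
qed (use assms in simp)

text \<open>\<open>A\<close> commutes with multiplication by -\<Lambda>, so the binomial theorem
  applies to A - \<Lambda>; the induction step is Pascal's rule.\<close>

lemma gen_pow_binomial:
  "(gen ^^ k) f = (\<lambda>x. \<Sum>i\<le>k. real (k choose i) * (- \<Lambda>) ^ (k - i) * (A ^^ i) f x)"
proof (induction k)
  case (Suc k)
  let ?a = "\<lambda>k i. real (k choose i) * (- \<Lambda>) ^ (k - i)"
  show ?case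
  proof
    fix x
    let ?F = "\<lambda>i. (A ^^ i) f x"
    have "(gen ^^ Suc k) f x = (\<Sum>i\<le>k. ?a k i * ?F (Suc i)) - \<Lambda> * (\<Sum>i\<le>k. ?a k i * ?F i)"
      by (simp add: Suc gen_def A_sum scale)
    also have "\<Lambda> * (\<Sum>i\<le>k. ?a k i * ?F i)
        = - (\<Sum>i\<le>k. real (k choose i) * (- \<Lambda>) ^ (Suc k - i) * ?F i)"
      by (simp add: sum_distrib_left sum_negf[symmetric] Suc_diff_le mult_ac)
    \<comment> \<open>The extra summand vanishes because \<open>k choose Suc k\<close> is 0. The
      longer range lets the index shift below align both sums on \<open>A ^^ Suc i\<close>.\<close>
    also have "(\<Sum>i\<le>k. real (k choose i) * (- \<Lambda>) ^ (Suc k - i) * ?F i)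
        = (\<Sum>i\<le>Suc k. real (k choose i) * (- \<Lambda>) ^ (Suc k - i) * ?F i)"
      by simp
    also have "\<dots> = (- \<Lambda>) ^ Suc k * ?F 0
        + (\<Sum>i\<le>k. real (k choose Suc i) * (- \<Lambda>) ^ (k - i) * ?F (Suc i))"
      by (subst sum.atMost_Suc_shift) simp
    also have "(\<Sum>i\<le>k. ?a k i * ?F (Suc i)) - - \<dots> = (\<Sum>i\<le>Suc k. ?a (Suc k) i * ?F i)"
      by (subst sum.atMost_Suc_shift)
        (simp add: sum.distrib[symmetric] algebra_simps del: sum.atMost_Suc)
    finally show "(gen ^^ Suc k) f x = (\<Sum>i\<le>Suc k. ?a (Suc k) i * ?F i)" .
  qed
qed simp

text \<open>Since the k-th power of \<open>A\<close> has norm at most \<Lambda>^k, the exponential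
  series of |t| * \<Lambda>, times \<open>B\<close>, dominates.\<close>

lemma A_pow_summable:
  assumes "\<And>x. \<bar>f x\<bar> \<le> B"
  shows "summable (\<lambda>k. norm (t ^ k / fact k * (A ^^ k) f x))"
proof (rule summable_comparison_test)
  show "\<exists>N. \<forall>k\<ge>N. norm (norm (t ^ k / fact k * (A ^^ k) f x))
      \<le> (\<bar>t\<bar> * \<Lambda>) ^ k /\<^sub>R fact k * B"
  proof (intro exI allI impI)
    fix k
    have "\<bar>t\<bar> ^ k / fact k * \<bar>(A ^^ k) f x\<bar> \<le> \<bar>t\<bar> ^ k / fact k * (\<Lambda> ^ k * B)"
      by (intro mult_left_mono A_pow_bound assms) auto
    then show "norm (norm (t ^ k / fact k * (A ^^ k) f x)) \<le> (\<bar>t\<bar> * \<Lambda>) ^ k /\<^sub>R fact k * B"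
      by (simp add: abs_mult power_abs power_mult_distrib divide_inverse mult_ac)
  qed
  show "summable (\<lambda>k. (\<bar>t\<bar> * \<Lambda>) ^ k /\<^sub>R fact k * B)"
    by (intro summable_mult2 summable_exp_generic)
qed

text \<open>Uniformisation: \<open>e\<^bsup>t(A - \<Lambda>)\<^esup> = e\<^bsup>-\<Lambda>t\<^esup> e\<^bsup>tA\<^esup>\<close> trades the signed generator for the positive \<open>A\<close>.\<close>

lemma semigroup_sums:
  assumes "\<And>x. \<bar>f x\<bar> \<le> B"
  shows "(\<lambda>k. t ^ k / fact k * (gen ^^ k) f x)
    sums (exp (- \<Lambda> * t) * (\<Sum>k. t ^ k / fact k * (A ^^ k) f x))"
proof -
  \<comment> \<open>Cauchy product of the series for e^(tA) f at x with the scalar series for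
    e^(-\<Lambda>t). Its k-th term is matched with the binomial expansion of
    \<open>gen ^^ k\<close>.\<close>
  have "(\<lambda>k. \<Sum>i\<le>k. (t ^ i / fact i * (A ^^ i) f x) * ((- \<Lambda> * t) ^ (k - i) /\<^sub>R fact (k - i)))
    sums ((\<Sum>k. t ^ k / fact k * (A ^^ k) f x) * (\<Sum>k. (- \<Lambda> * t) ^ k /\<^sub>R fact k))"
    by (intro Cauchy_product_sums A_pow_summable[OF assms] summable_norm_exp)
  also have "(\<lambda>k. \<Sum>i\<le>k. (t ^ i / fact i * (A ^^ i) f x) * ((- \<Lambda> * t) ^ (k - i) /\<^sub>R fact (k - i)))
    = (\<lambda>k. t ^ k / fact k * (gen ^^ k) f x)"
  proof
    fix k
    have "(t ^ i / fact i * F) * ((- \<Lambda> * t) ^ (k - i) /\<^sub>R fact (k - i))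
        = t ^ k / fact k * (real (k choose i) * (- \<Lambda>) ^ (k - i) * F)" if "i \<le> k" for i F
    proof -
      have "t ^ k = t ^ i * t ^ (k - i)" using that by (simp flip: power_add)
      moreover have "real (k choose i) = fact k / (fact i * fact (k - i))"
        using that by (rule binomial_fact)
      moreover have "(- \<Lambda> * t) ^ (k - i) = (- \<Lambda>) ^ (k - i) * t ^ (k - i)"
        by (rule power_mult_distrib)
      ultimately show ?thesis by (simp only:) (simp add: field_simps)
    qed
    then show "(\<Sum>i\<le>k. (t ^ i / fact i * (A ^^ i) f x) * ((- \<Lambda> * t) ^ (k - i) /\<^sub>R fact (k - i)))
        = t ^ k / fact k * (gen ^^ k) f x"
      by (simp add: gen_pow_binomial sum_distrib_left)
  qed
  also have "(\<Sum>k. (- \<Lambda> * t) ^ k /\<^sub>R fact k) = exp (- \<Lambda> * t)"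
    by (simp add: exp_def)
  finally show ?thesis by (simp add: mult.commute)
qed

lemma semigroup_eq:
  assumes "\<And>x. \<bar>f x\<bar> \<le> B"
  shows "semigroup_of gen t f x = exp (- \<Lambda> * t) * (\<Sum>k. t ^ k / fact k * (A ^^ k) f x)"
  unfolding semigroup_of_def using semigroup_sums[OF assms] by (rule sums_unique[symmetric])

text \<open>Linearity, applied to the indicator of S as a sum of indicators of points. It turns
  transition probabilities into probabilities of events, the quantities that total variation
  compares.\<close>

lemma sum_trans_prob:
  assumes "finite S"
  shows "(\<Sum>y\<in>S. trans_prob gen t x y) = semigroup_of gen t (indicator S) x"
proof -
  have ind: "indicator S = (\<lambda>x. \<Sum>y\<in>S. indicator {y} x :: real)"
    using assms by (auto simp: fun_eq_iff indicator_def sum.delta if_distrib cong: if_cong)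
  have "semigroup_of gen t (indicator S) x
      = (\<Sum>k. \<Sum>y\<in>S. t ^ k / fact k * (gen ^^ k) (indicator {y}) x)"
    using assms by (subst ind) (simp add: semigroup_of_def gen_pow_sum sum_distrib_left)
  also have "\<dots> = (\<Sum>y\<in>S. \<Sum>k. t ^ k / fact k * (gen ^^ k) (indicator {y}) x)"
    \<comment> \<open>Swapping the finite sum with the series needs each series to converge;
      indicators are bounded by 1, so \<open>semigroup_sums\<close> applies.\<close>
    by (intro suminf_sum sums_summable[OF semigroup_sums[where B = 1]]) (simp add: indicator_def)
  finally show ?thesis by (simp add: trans_prob_def semigroup_of_def)
qed

text \<open>Termwise, the increments of e^(tA) f between x and y sum to at most e^((\<Lambda> -
  c)t), and the factor e^(-\<Lambda>t) from uniformisation leaves e^(-ct). The bound on f serves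
  only convergence; the rate comes from the increments.\<close>

lemma semigroup_contraction:
  assumes t: "0 \<le> t" and bdd: "\<And>x. \<bar>f x\<bar> \<le> B"
    and incr: "\<And>k. \<bar>(A ^^ k) f x - (A ^^ k) f y\<bar> \<le> (\<Lambda> - c) ^ k"
  shows "\<bar>semigroup_of gen t f x - semigroup_of gen t f y\<bar> \<le> exp (- c * t)"
proof -
  let ?s = "\<lambda>x k. t ^ k / fact k * (A ^^ k) f x"
  have sm: "summable (?s x)" for x
    by (rule summable_norm_cancel, rule A_pow_summable[OF bdd])
  have le: "norm (?s x k - ?s y k) \<le> ((\<Lambda> - c) * t) ^ k /\<^sub>R fact k" for k
  proof -
    have "?s x k - ?s y k = t ^ k / fact k * ((A ^^ k) f x - (A ^^ k) f y)"
      by (simp only: right_diff_distrib)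
    then have "norm (?s x k - ?s y k) = t ^ k / fact k * \<bar>(A ^^ k) f x - (A ^^ k) f y\<bar>"
      using t by (simp only: real_norm_def abs_mult) simp
    also have "\<dots> \<le> t ^ k / fact k * (\<Lambda> - c) ^ k"
      using t by (intro mult_left_mono incr) auto
    finally show ?thesis
      by (simp only: power_mult_distrib divide_inverse real_scaleR_def mult_ac)
  qed
  have "\<bar>(\<Sum>k. ?s x k) - (\<Sum>k. ?s y k)\<bar> = norm (\<Sum>k. ?s x k - ?s y k)"
    by (simp only: suminf_diff[OF sm sm] real_norm_def)
  also have "\<dots> \<le> (\<Sum>k. ((\<Lambda> - c) * t) ^ k /\<^sub>R fact k)"
    by (intro norm_suminf_le le summable_exp_generic)
  also have "\<dots> = exp ((\<Lambda> - c) * t)" by (simp add: exp_def)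
  finally have "exp (- \<Lambda> * t) * \<bar>(\<Sum>k. ?s x k) - (\<Sum>k. ?s y k)\<bar>
      \<le> exp (- \<Lambda> * t) * exp ((\<Lambda> - c) * t)"
    by (intro mult_left_mono) auto
  also have "\<dots> = exp (- c * t)" by (simp flip: exp_add add: algebra_simps)
  finally show ?thesis
    by (simp add: semigroup_eq[OF bdd] right_diff_distrib[symmetric] abs_mult)
qed

end

section \<open>The multicoloured hardcore model\<close>

definition free_colour :: "'a set \<Rightarrow> 'a set set \<Rightarrow> ('a \<Rightarrow> nat) \<Rightarrow> 'a \<Rightarrow> nat \<Rightarrow> bool" where
  "free_colour V E \<sigma> v k \<longleftrightarrow> (\<forall>u\<in>V. {u, v} \<in> E \<longrightarrow> \<sigma> u \<noteq> k)"

text \<open>The expectation of f under \<open>mch_update\<close> in closed form: linearity and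
  coupling become statements about one finite sum over colours.\<close>

definition resample ::
  "'a set \<Rightarrow> 'a set set \<Rightarrow> nat \<Rightarrow> ('a \<Rightarrow> real) \<Rightarrow> 'a \<Rightarrow> (('a \<Rightarrow> nat) \<Rightarrow> real) \<Rightarrow> ('a \<Rightarrow> nat) \<Rightarrow> real" where
  "resample V E K p v f \<sigma> = (1 - p v) * f (\<sigma>(v := 0))
     + p v / real K * (\<Sum>k=1..K. f (\<sigma>(v := (if free_colour V E \<sigma> v k then k else 0))))"

lemma expectation_mch_update:
  assumes "1 \<le> K" "0 \<le> p v" "p v \<le> 1"
  shows "measure_pmf.expectation (mch_update V E K p v \<sigma>) f = resample V E K p v f \<sigma>"
proof -
  \<comment> \<open>\<open>D C\<close> is the law of the update given the coin \<open>C\<close>; the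
    expectation is then a two-term sum over \<open>C\<close>.\<close>
  define D where "D = (\<lambda>C. bind_pmf (pmf_of_set {1..K}) (\<lambda>k.
     return_pmf (\<sigma>(v := (if C \<and> free_colour V E \<sigma> v k then k else 0)))))"
  have ne: "{1..K} \<noteq> {}" using assms by auto
  have "set_pmf (pmf_of_set {1..K}) = {1..K}" by (rule set_pmf_of_set[OF ne]) simp
  then have fin: "finite (set_pmf (D C))" for C
    by (simp only: D_def set_bind_pmf) simp
  have D: "measure_pmf.expectation (D C) f
      = (\<Sum>k=1..K. f (\<sigma>(v := (if C \<and> free_colour V E \<sigma> v k then k else 0)))) / K" for C
    unfolding D_def
    by (subst pmf_expectation_bind_pmf_of_set[OF ne])
      (simp_all add: divide_inverse mult_ac sum_distrib_left)
  have "mch_update V E K p v \<sigma> = bind_pmf (bernoulli_pmf (p v)) D"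
    by (simp add: mch_update_def D_def free_colour_def)
  then have "measure_pmf.expectation (mch_update V E K p v \<sigma>) f
      = (\<Sum>C\<in>UNIV. pmf (bernoulli_pmf (p v)) C *\<^sub>R measure_pmf.expectation (D C) f)"
    using fin by (simp only:) (rule pmf_expectation_bind; simp)
  then show ?thesis
    using assms by (simp add: UNIV_bool D resample_def)
qed

lemma resample_add:
  "resample V E K p v (\<lambda>x. f x + g x) \<sigma> = resample V E K p v f \<sigma> + resample V E K p v g \<sigma>"
  by (simp add: resample_def algebra_simps sum.distrib)

lemma resample_scale:
  "resample V E K p v (\<lambda>x. a * f x) \<sigma> = a * resample V E K p v f \<sigma>"
  by (simp add: resample_def algebra_simps sum_distrib_left)

lemma resample_bound:
  assumes "1 \<le> K" "0 \<le> p v" "p v \<le> 1" and f: "\<And>x. \<bar>f x\<bar> \<le> B"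
  shows "\<bar>resample V E K p v f \<sigma>\<bar> \<le> B"
proof -
  let ?S = "\<Sum>k=1..K. f (\<sigma>(v := (if free_colour V E \<sigma> v k then k else 0)))"
  have "\<bar>?S\<bar> \<le> (\<Sum>k=1..K. B)"
    by (rule order_trans[OF sum_abs sum_mono]) (rule f)
  then have S: "\<bar>?S\<bar> \<le> real K * B" by simp
  have "\<bar>resample V E K p v f \<sigma>\<bar> \<le> (1 - p v) * \<bar>f (\<sigma>(v := 0))\<bar> + p v / real K * \<bar>?S\<bar>"
    unfolding resample_def using assms(1-3)
    by (intro order_trans[OF abs_triangle_ineq]) (simp add: abs_mult)
  also have "\<dots> \<le> (1 - p v) * B + p v / real K * (real K * B)"
    using assms(1-3) S by (intro add_mono mult_left_mono f) auto
  also have "\<dots> = B" using assms(1) by (simp add: field_simps)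
  finally show ?thesis .
qed

section \<open>Configuration space: closure under updates, and finiteness\<close>

lemma configs_upd:
  assumes gr: "simple_graph V E" and \<sigma>: "\<sigma> \<in> configs V E K" and v: "v \<in> V"
    and c: "c \<le> K" "c = 0 \<or> free_colour V E \<sigma> v c"
  shows "\<sigma>(v := c) \<in> configs V E K"
proof -
  have nl: "{v, v} \<notin> E"
    using gr by (auto simp: simple_graph_def)
  have "\<sigma>(v := c) \<in> V \<rightarrow>\<^sub>E {0..K}"
    using \<sigma> v c by (auto simp: configs_def PiE_iff extensional_def)
  moreover have "(\<sigma>(v := c)) u \<noteq> (\<sigma>(v := c)) u'"
    if u: "u \<in> V" "u' \<in> V" "{u, u'} \<in> E" and pos: "(\<sigma>(v := c)) u + (\<sigma>(v := c)) u' > 0" for u u'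
  proof -
    have "{u', u} \<in> E" using u(3) by (simp add: insert_commute)
    then show ?thesis
      using u pos c nl \<sigma> unfolding configs_def free_colour_def
      by (cases "u = v"; cases "u' = v") auto
  qed
  ultimately show ?thesis by (auto simp: configs_def)
qed

lemma configs_deactivate:
  "simple_graph V E \<Longrightarrow> \<sigma> \<in> configs V E K \<Longrightarrow> v \<in> V \<Longrightarrow> \<sigma>(v := 0) \<in> configs V E K"
  by (rule configs_upd) auto

lemma finite_configs: "finite V \<Longrightarrow> finite (configs V E K)"
  by (rule finite_subset[of _ "V \<rightarrow>\<^sub>E {0..K}"]) (auto simp: configs_def intro: finite_PiE)

section \<open>Coupled updates of observables that are Lipschitz under deactivation\<close>

definition deact_lipschitz :: "'a set \<Rightarrow> ('a \<Rightarrow> nat) set \<Rightarrow> real \<Rightarrow> (('a \<Rightarrow> nat) \<Rightarrow> real) \<Rightarrow> bool" where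
  "deact_lipschitz V S B f \<longleftrightarrow> (\<forall>\<sigma>\<in>S. \<forall>w\<in>V. \<bar>f \<sigma> - f (\<sigma>(w := 0))\<bar> \<le> B)"

lemma deact_lipschitzD:
  "deact_lipschitz V S B f \<Longrightarrow> \<sigma> \<in> S \<Longrightarrow> w \<in> V \<Longrightarrow> \<bar>f \<sigma> - f (\<sigma>(w := 0))\<bar> \<le> B"
  by (simp add: deact_lipschitz_def)

text \<open>Without loops, the update of w never looks at the colour of w. Hence a discrepancy at w
  disappears when w is selected.\<close>

lemma resample_same:
  assumes "simple_graph V E"
  shows "resample V E K p w f (\<sigma>(w := 0)) = resample V E K p w f \<sigma>"
proof -
  have "{w, w} \<notin> E" using assms by (auto simp: simple_graph_def)
  then have "free_colour V E (\<sigma>(w := 0)) w k = free_colour V E \<sigma> w k" for k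
    by (auto simp: free_colour_def)
  then show ?thesis by (simp add: resample_def)
qed

text \<open>Both copies use the same colour k at v. They decide differently only if w alone blocks
  k, that is, w is a neighbour of v with colour k. Then v becomes a second discrepancy, and the
  triangle inequality through the configuration with both v and w inactive costs 2 * B.\<close>

lemma coupled_update:
  assumes gr: "simple_graph V E" and \<sigma>: "\<sigma> \<in> configs V E K" and vw: "v \<in> V" "w \<in> V" "v \<noteq> w"
    and f: "deact_lipschitz V (configs V E K) B f" and k: "1 \<le> k" "k \<le> K"
  shows "\<bar>f (\<sigma>(v := (if free_colour V E \<sigma> v k then k else 0)))
      - f (\<sigma>(w := 0, v := (if free_colour V E (\<sigma>(w := 0)) v k then k else 0)))\<bar>
    \<le> B + (if {v, w} \<in> E \<and> k = \<sigma> w then B else 0)"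
proof -
  let ?\<eta> = "\<sigma>(w := 0)"
  have \<eta>: "?\<eta> \<in> configs V E K" using gr \<sigma> vw by (intro configs_deactivate)
  have same: "\<bar>f (\<sigma>(v := c)) - f (?\<eta>(v := c))\<bar> \<le> B" if "\<sigma>(v := c) \<in> configs V E K" for c
    using deact_lipschitzD[OF f that vw(2)] vw(3) by (simp add: fun_upd_twist)
  have B: "0 \<le> B" using deact_lipschitzD[OF f \<sigma> vw(2)] by linarith
  \<comment> \<open>As k is at least 1, the colour 0 now at w cannot block it.\<close>
  have mono: "free_colour V E ?\<eta> v k" if "free_colour V E \<sigma> v k"
    using that k by (auto simp: free_colour_def)
  show ?thesis
  proof (cases "free_colour V E \<sigma> v k = free_colour V E ?\<eta> v k")
    case True
    then have "\<bar>f (\<sigma>(v := (if free_colour V E \<sigma> v k then k else 0)))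
      - f (?\<eta>(v := (if free_colour V E ?\<eta> v k then k else 0)))\<bar> \<le> B"
      using same configs_upd[OF gr \<sigma> vw(1)] k by auto
    with B show ?thesis by auto
  next
    case False
    with mono have fr: "\<not> free_colour V E \<sigma> v k" "free_colour V E ?\<eta> v k" by auto
    then obtain u where u: "u \<in> V" "{u, v} \<in> E" "\<sigma> u = k" "?\<eta> u \<noteq> k"
      unfolding free_colour_def by blast
    then have "u = w" by (cases "u = w") auto
    then have adj: "{v, w} \<in> E \<and> k = \<sigma> w" using u by (simp add: insert_commute)
    have "\<bar>f (\<sigma>(v := 0)) - f (?\<eta>(v := 0))\<bar> \<le> B"
      using same configs_upd[OF gr \<sigma> vw(1)] by auto
    moreover have "\<bar>f (?\<eta>(v := k)) - f (?\<eta>(v := 0))\<bar> \<le> B"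
      using deact_lipschitzD[OF f configs_upd[OF gr \<eta> vw(1)] vw(1), of k] fr(2) k by simp
    ultimately show ?thesis using fr adj by auto
  qed
qed

text \<open>Averaging \<open>coupled_update\<close> over k: at most one colour, that of w, incurs
  the extra B, and it is drawn with a successful coin with probability p v / K.\<close>

lemma resample_diff:
  assumes gr: "simple_graph V E" and \<sigma>: "\<sigma> \<in> configs V E K" and vw: "v \<in> V" "w \<in> V" "v \<noteq> w"
    and f: "deact_lipschitz V (configs V E K) B f" and K: "1 \<le> K" and p: "0 \<le> p v" "p v \<le> 1"
  shows "\<bar>resample V E K p v f \<sigma> - resample V E K p v f (\<sigma>(w := 0))\<bar>
    \<le> B + (if {v, w} \<in> E then p v / K * B else 0)"
proof -
  let ?\<eta> = "\<sigma>(w := 0)"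
  let ?d = "\<lambda>k. f (\<sigma>(v := (if free_colour V E \<sigma> v k then k else 0)))
      - f (?\<eta>(v := (if free_colour V E ?\<eta> v k then k else 0)))"
  have B: "0 \<le> B" using deact_lipschitzD[OF f \<sigma> vw(2)] by linarith
  \<comment> \<open>The failed coin: v becomes inactive in both copies and w remains the only
    possible discrepancy.\<close>
  have zero: "\<bar>f (\<sigma>(v := 0)) - f (?\<eta>(v := 0))\<bar> \<le> B"
    using deact_lipschitzD[OF f configs_deactivate[OF gr \<sigma> vw(1)] vw(2)] vw(3)
    by (simp add: fun_upd_twist)
  have "\<bar>sum ?d {1..K}\<bar> \<le> (\<Sum>k=1..K. B + (if {v, w} \<in> E \<and> k = \<sigma> w then B else 0))"
  proof (rule order_trans[OF sum_abs sum_mono])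
    fix k assume "k \<in> {1..K}"
    then have k: "1 \<le> k" "k \<le> K" by simp_all
    show "\<bar>?d k\<bar> \<le> B + (if {v, w} \<in> E \<and> k = \<sigma> w then B else 0)"
      by (rule coupled_update[OF gr \<sigma> vw f k])
  qed
  \<comment> \<open>An inequality, since no k in {1..K} equals \<open>\<sigma> w\<close> when w is
    inactive.\<close>
  also have "\<dots> \<le> K * B + (if {v, w} \<in> E then B else 0)"
    using B by (cases "{v, w} \<in> E") (simp_all add: sum.distrib)
  finally have S: "\<bar>sum ?d {1..K}\<bar> \<le> K * B + (if {v, w} \<in> E then B else 0)" .
  have convex: "(1 - q) * a + r * s - ((1 - q) * b + r * u) = (1 - q) * (a - b) + r * (s - u)"
    for q a b r s u :: real
    by (simp add: algebra_simps)
  have "\<bar>resample V E K p v f \<sigma> - resample V E K p v f ?\<eta>\<bar>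
      = \<bar>(1 - p v) * (f (\<sigma>(v := 0)) - f (?\<eta>(v := 0))) + p v / K * sum ?d {1..K}\<bar>"
    unfolding resample_def sum_subtractf by (rule arg_cong[OF convex])
  also have "\<dots> \<le> (1 - p v) * \<bar>f (\<sigma>(v := 0)) - f (?\<eta>(v := 0))\<bar> + p v / K * \<bar>sum ?d {1..K}\<bar>"
    using p by (intro order_trans[OF abs_triangle_ineq]) (simp add: abs_mult)
  also have "\<dots> \<le> (1 - p v) * B + p v / K * (K * B + (if {v, w} \<in> E then B else 0))"
    using p by (intro add_mono[OF mult_left_mono[OF zero] mult_left_mono[OF S]]) simp_all
  also have "\<dots> = B + (if {v, w} \<in> E then p v / K * B else 0)"
    using K by (cases "{v, w} \<in> E") (simp_all add: field_simps)
  finally show ?thesis .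
qed

text \<open>Deactivating the vertices one at a time leads from x and from y to the empty
  configuration in \<open>card V\<close> adjacent steps each. Deactivation preserves properness, so
  the paths stay inside the configuration space.\<close>

lemma deact_lipschitz_diameter:
  assumes gr: "simple_graph V E" and g: "deact_lipschitz V (configs V E K) B g"
    and x: "x \<in> configs V E K" and y: "y \<in> configs V E K"
  shows "\<bar>g x - g y\<bar> \<le> 2 * real (card V) * B"
proof -
  have fin: "finite V" using gr by (simp add: simple_graph_def)
  let ?z = "\<lambda>W \<sigma> v. if v \<in> W then 0 else \<sigma> v :: nat"
  have path: "?z W \<sigma> \<in> configs V E K \<and> \<bar>g \<sigma> - g (?z W \<sigma>)\<bar> \<le> real (card W) * B"
    if "W \<subseteq> V" "\<sigma> \<in> configs V E K" for W \<sigma>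
    using finite_subset[OF that(1) fin] that(1)
  proof (induction W rule: finite_induct)
    case (insert w W)
    then have IH: "?z W \<sigma> \<in> configs V E K" "\<bar>g \<sigma> - g (?z W \<sigma>)\<bar> \<le> real (card W) * B"
      and w: "w \<in> V" by auto
    have eq: "?z (insert w W) \<sigma> = (?z W \<sigma>)(w := 0)" by (simp add: fun_eq_iff)
    have "\<bar>g (?z W \<sigma>) - g ((?z W \<sigma>)(w := 0))\<bar> \<le> B"
      using g IH(1) w by (rule deact_lipschitzD)
    with IH(2) have "\<bar>g \<sigma> - g ((?z W \<sigma>)(w := 0))\<bar> \<le> real (card (insert w W)) * B"
      using insert.hyps by (simp add: algebra_simps)
    moreover have "(?z W \<sigma>)(w := 0) \<in> configs V E K"
      using gr IH(1) w by (rule configs_deactivate)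
    ultimately show ?case unfolding eq by simp
  qed (use that(2) in simp)
  \<comment> \<open>Outside V both functions are \<open>undefined\<close> by extensionality, so the
    two paths end in the same function.\<close>
  have "?z V x = ?z V y"
  proof
    fix v
    show "?z V x v = ?z V y v"
      using x y PiE_arb[of x V "\<lambda>_. {0..K}" v] PiE_arb[of y V "\<lambda>_. {0..K}" v]
      by (cases "v \<in> V") (simp_all add: configs_def)
  qed
  then have "g (?z V x) = g (?z V y)" by (rule arg_cong)
  moreover have "\<bar>g x - g (?z V x)\<bar> \<le> real (card V) * B" "\<bar>g y - g (?z V y)\<bar> \<le> real (card V) * B"
    by (fact path[OF subset_refl x, THEN conjunct2] path[OF subset_refl y, THEN conjunct2])+
  ultimately show ?thesis by linarith
qed

section \<open>Contraction for update rates proportional to the degree\<close>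

locale mch_chain =
  fixes V :: "'a set" and E :: "'a set set" and K :: nat and lam p :: "'a \<Rightarrow> real"
  assumes graph: "simple_graph V E"
    and min_deg: "1 \<le> min_degree V E"
    and K_pos: "1 \<le> K"
    and p_range: "v \<in> V \<Longrightarrow> 0 \<le> p v \<and> p v \<le> 1"
    and lam_eq: "v \<in> V \<Longrightarrow> lam v = real (vertex_degree V E v) / avg_degree V E"
    and p_le: "v \<in> V \<Longrightarrow> p v \<le> 2 / 3 * real K / real (vertex_degree V E v)"
begin

abbreviation "\<Omega> \<equiv> configs V E K"
abbreviation "rate \<equiv> real (min_degree V E) / (3 * avg_degree V E)"
abbreviation "L \<equiv> mch_generator V E K lam p"

definition jump :: "(('a \<Rightarrow> nat) \<Rightarrow> real) \<Rightarrow> ('a \<Rightarrow> nat) \<Rightarrow> real" where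
  "jump f \<sigma> = (\<Sum>v\<in>V. lam v * resample V E K p v f \<sigma>)"

lemma finite_V: "finite V" and V_nonempty: "V \<noteq> {}"
  using graph by (auto simp: simple_graph_def)

lemma min_degree_le: "v \<in> V \<Longrightarrow> min_degree V E \<le> vertex_degree V E v"
  by (simp add: min_degree_def finite_V)

lemma degree_pos: "v \<in> V \<Longrightarrow> 1 \<le> vertex_degree V E v"
  using min_degree_le min_deg by (rule order_trans[rotated])

lemma avg_degree_pos: "0 < avg_degree V E"
proof -
  have "0 < (\<Sum>v\<in>V. real (vertex_degree V E v))"
    using degree_pos by (intro sum_pos finite_V V_nonempty) (auto simp: Suc_le_eq)
  then show ?thesis
    using finite_V V_nonempty by (simp add: avg_degree_def card_gt_0_iff)
qed

lemma lam_nonneg: "v \<in> V \<Longrightarrow> 0 \<le> lam v"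
  using avg_degree_pos by (simp add: lam_eq)

lemma jump_operator: "jump_operator jump (sum lam V)"
proof
  fix f g :: "('a \<Rightarrow> nat) \<Rightarrow> real" and a B :: real and x
  show "jump (\<lambda>x. f x + g x) = (\<lambda>x. jump f x + jump g x)"
    by (simp add: jump_def fun_eq_iff resample_add ring_distribs sum.distrib)
  show "jump (\<lambda>x. a * f x) = (\<lambda>x. a * jump f x)"
    by (simp add: jump_def fun_eq_iff resample_scale sum_distrib_left mult_ac)
  assume f: "\<And>x. \<bar>f x\<bar> \<le> B"
  have "\<bar>jump f x\<bar> \<le> (\<Sum>v\<in>V. lam v * B)"
    unfolding jump_def
  proof (rule order_trans[OF sum_abs sum_mono])
    fix v assume v: "v \<in> V"
    show "\<bar>lam v * resample V E K p v f x\<bar> \<le> lam v * B"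
      using resample_bound[of K p v f B V E x] f K_pos p_range[OF v] lam_nonneg[OF v]
      by (simp add: abs_mult mult_left_mono)
  qed
  then show "\<bar>jump f x\<bar> \<le> sum lam V * B" by (simp add: sum_distrib_right)
qed

sublocale jump_operator jump "sum lam V"
  by (rule jump_operator)

text \<open>Collecting the terms \<open>- lam v * f \<sigma>\<close> of the generator gives the
  total rate \<open>sum lam V\<close>, so the results on uniformisation apply to
  \<open>L\<close>.\<close>

lemma gen_eq: "gen = L"
proof (intro ext)
  fix f \<sigma>
  have "L f \<sigma> = (\<Sum>v\<in>V. lam v * (resample V E K p v f \<sigma> - f \<sigma>))"
    unfolding mch_generator_def using K_pos p_range
    by (intro sum.cong refl) (simp add: expectation_mch_update)
  then show "gen f \<sigma> = L f \<sigma>"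
    by (simp add: gen_def jump_def right_diff_distrib sum_subtractf sum_distrib_right)
qed

text \<open>Each v other than w contributes \<open>lam v * B\<close>, w contributes nothing, and
  each neighbour of w adds at most 2/(3 * dbar) * B. With lam w = d_w/dbar and d_w neighbours, the
  net loss is d_w/dbar - 2 * d_w/(3 * dbar) = d_w/(3 * dbar).\<close>

lemma jump_contraction:
  assumes f: "deact_lipschitz V \<Omega> B f"
  shows "deact_lipschitz V \<Omega> ((sum lam V - rate) * B) (jump f)"
  unfolding deact_lipschitz_def
proof (intro ballI)
  fix \<sigma> w assume \<sigma>: "\<sigma> \<in> \<Omega>" and w: "w \<in> V"
  let ?a = "avg_degree V E" and ?N = "{v \<in> V. {v, w} \<in> E}"
  have B: "0 \<le> B" using deact_lipschitzD[OF f \<sigma> w] by linarith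
  have wN: "w \<notin> ?N" using graph by (auto simp: simple_graph_def)
  \<comment> \<open>The degree of v cancels between \<open>lam v\<close> and the bound on
    \<open>p v\<close>, which makes the infection rate uniform over the neighbours.\<close>
  have infect: "lam v * (p v / K) \<le> 2 / (3 * ?a)" if v: "v \<in> V" for v
  proof -
    have d: "0 < real (vertex_degree V E v)" using degree_pos[OF v] by simp
    have "lam v * (p v / K) \<le> lam v * (2 / 3 * real K / real (vertex_degree V E v) / K)"
      using p_le[OF v] by (intro mult_left_mono divide_right_mono lam_nonneg v) auto
    also have "\<dots> = 2 / (3 * ?a)"
      using d K_pos avg_degree_pos by (simp add: lam_eq[OF v] field_simps)
    finally show ?thesis .
  qed
  have "\<bar>jump f \<sigma> - jump f (\<sigma>(w := 0))\<bar>
      = \<bar>\<Sum>v\<in>V. lam v * (resample V E K p v f \<sigma> - resample V E K p v f (\<sigma>(w := 0)))\<bar>"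
    by (simp add: jump_def sum_subtractf right_diff_distrib)
  also have "\<dots> = \<bar>\<Sum>v\<in>V - {w}. lam v * (resample V E K p v f \<sigma> - resample V E K p v f (\<sigma>(w := 0)))\<bar>"
    using w by (subst sum.remove[OF finite_V w]) (simp add: resample_same[OF graph])
  also have "\<dots> \<le> (\<Sum>v\<in>V - {w}. lam v * B + (if {v, w} \<in> E then 2 / (3 * ?a) * B else 0))"
  proof (rule order_trans[OF sum_abs sum_mono])
    fix v assume v: "v \<in> V - {w}"
    let ?r = "resample V E K p v f \<sigma> - resample V E K p v f (\<sigma>(w := 0))"
    have "\<bar>lam v * ?r\<bar> = lam v * \<bar>?r\<bar>" using lam_nonneg v by (simp add: abs_mult)
    also have "\<dots> \<le> lam v * (B + (if {v, w} \<in> E then p v / K * B else 0))"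
      using v w p_range[of v] K_pos lam_nonneg[of v]
      by (intro mult_left_mono resample_diff graph \<sigma> f) auto
    also have "\<dots> = lam v * B + (if {v, w} \<in> E then lam v * (p v / K) * B else 0)"
      by (simp add: algebra_simps)
    also have "\<dots> \<le> lam v * B + (if {v, w} \<in> E then 2 / (3 * ?a) * B else 0)"
      using mult_right_mono[OF infect[of v] B] v by simp
    finally show "\<bar>lam v * ?r\<bar> \<le> lam v * B + (if {v, w} \<in> E then 2 / (3 * ?a) * B else 0)" .
  qed
  also have "\<dots> = (sum lam V - lam w) * B + real (card ?N) * (2 / (3 * ?a) * B)"
  proof -
    have "(\<Sum>v\<in>V - {w}. if {v, w} \<in> E then 2 / (3 * ?a) * B else 0) = (\<Sum>v\<in>?N. 2 / (3 * ?a) * B)"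
      using wN finite_V by (intro sum.mono_neutral_cong_right) auto
    then show ?thesis
      by (simp add: sum.distrib sum_distrib_right[symmetric] sum_diff1[OF finite_V] w)
  qed
  also have "\<dots> = (sum lam V - real (vertex_degree V E w) / (3 * ?a)) * B"
    using avg_degree_pos by (simp add: lam_eq[OF w] vertex_degree_def field_simps)
  \<comment> \<open>The loss is smallest at a vertex of minimum degree; replacing d_w by \<delta>
    makes the bound uniform in w.\<close>
  also have "\<dots> \<le> (sum lam V - rate) * B"
    using min_degree_le[OF w] avg_degree_pos B
    by (intro mult_right_mono diff_left_mono divide_right_mono) auto
  finally show "\<bar>jump f \<sigma> - jump f (\<sigma>(w := 0))\<bar> \<le> (sum lam V - rate) * B" .
qed

lemma jump_pow_contraction:
  "deact_lipschitz V \<Omega> 1 f \<Longrightarrow> deact_lipschitz V \<Omega> ((sum lam V - rate) ^ k) ((jump ^^ k) f)"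
  by (induction k) (auto dest: jump_contraction)

text \<open>An indicator changes by at most 1 along an adjacent pair, and iterating
  \<open>jump_contraction\<close> supplies the increments for \<open>semigroup_contraction\<close>.
  So at time t the constant is exp (- rate * t), and the path through the empty configuration gives
  the factor 2n.\<close>

lemma semigroup_indicator_diff:
  assumes t: "0 \<le> t" and xy: "x \<in> \<Omega>" "y \<in> \<Omega>"
  shows "\<bar>semigroup_of L t (indicator S) x - semigroup_of L t (indicator S) y\<bar>
    \<le> 2 * real (card V) * exp (- rate * t)"
proof -
  have "deact_lipschitz V \<Omega> 1 (indicator S)"
    by (simp add: deact_lipschitz_def indicator_def)
  then have "deact_lipschitz V \<Omega> (exp (- rate * t)) (semigroup_of L t (indicator S))"
    unfolding deact_lipschitz_def[of V \<Omega> "exp _"] gen_eq[symmetric]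
    by (intro ballI semigroup_contraction[OF t, where B = 1] deact_lipschitzD[OF jump_pow_contraction])
      (auto simp: indicator_def)
  then show ?thesis by (rule deact_lipschitz_diameter[OF graph _ xy])
qed

section \<open>Laws of the chain, total variation and mixing time\<close>

lemma finite_\<Omega>: "finite \<Omega>"
  by (rule finite_configs[OF finite_V])

text \<open>The one-time law follows from the Markov property observed only at time 0, where the
  chain sits at x almost surely; events are then summed over their points.\<close>

lemma law_at_eq:
  assumes M: "markov_chain \<Omega> L x M X" and t: "0 \<le> t" and S: "S \<subseteq> \<Omega>" and x: "x \<in> \<Omega>"
  shows "measure (law_at \<Omega> M X t) S = semigroup_of L t (indicator S) x"
proof -
  interpret prob_space M using M by (simp add: markov_chain_def)
  have meas [measurable]: "X s \<in> measurable M (count_space \<Omega>)" if "0 \<le> s" for s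
    using M that by (simp add: markov_chain_def)
  have X0: "AE w in M. X 0 w = x" using M by (simp add: markov_chain_def)
  have "measure M {w \<in> space M. X t w = y} = trans_prob L t x y" if y: "y \<in> \<Omega>" for y
  proof -
    \<comment> \<open>The Markov clause with T = {0}, s = 0, h = t and z constantly x. The
      conditioning event has probability 1, so it drops out on both sides.\<close>
    have "prob {w \<in> space M. (\<forall>r\<in>{0}. X r w = x) \<and> X (0 + t) w = y}
        = prob {w \<in> space M. \<forall>r\<in>{0}. X r w = x} * trans_prob L t x y"
      using M t y unfolding markov_chain_def
      by (elim conjE allE[of _ "{0}"] allE[of _ 0] allE[of _ t] allE[of _ "\<lambda>_. x"] allE[of _ y]) auto
    moreover have "prob {w \<in> space M. X 0 w = x} = 1"
    proof (subst prob_Collect_eq_1)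
      show "{w \<in> space M. X 0 w = x} \<in> events"
        using measurable_sets[OF meas[OF order_refl], of "{x}"] x
        by (simp add: vimage_def Int_def conj_commute)
    qed (rule X0)
    moreover have "prob {w \<in> space M. X 0 w = x \<and> X t w = y} = prob {w \<in> space M. X t w = y}"
    proof (rule finite_measure_eq_AE)
      have m: "{w \<in> space M. X s w = z} \<in> events" if "0 \<le> s" "z \<in> \<Omega>" for s z
        using measurable_sets[OF meas[OF that(1)], of "{z}"] that(2)
        by (simp add: vimage_def Int_def conj_commute)
      show "{w \<in> space M. X t w = y} \<in> events" using t y by (rule m)
      have "{w \<in> space M. X 0 w = x \<and> X t w = y}
          = {w \<in> space M. X 0 w = x} \<inter> {w \<in> space M. X t w = y}" by auto
      then show "{w \<in> space M. X 0 w = x \<and> X t w = y} \<in> events"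
        using m[OF order_refl x] m[OF t y] by simp
    qed (use X0 in auto)
    ultimately show ?thesis by simp
  qed
  moreover have "measure (law_at \<Omega> M X t) {y} = measure M {w \<in> space M. X t w = y}" if "y \<in> \<Omega>" for y
    unfolding law_at_def using that meas[OF t]
    by (subst measure_distr) (auto intro!: arg_cong[of _ _ "measure M"])
  moreover have "measure (law_at \<Omega> M X t) S = (\<Sum>y\<in>S. measure (law_at \<Omega> M X t) {y})"
  proof -
    interpret P: prob_space "law_at \<Omega> M X t"
      unfolding law_at_def using meas[OF t] by (rule prob_space_distr)
    show ?thesis
      using S finite_subset[OF S finite_\<Omega>]
      by (intro P.finite_measure_eq_sum_singleton) (auto simp: law_at_def)
  qed
  ultimately have "measure (law_at \<Omega> M X t) S = (\<Sum>y\<in>S. trans_prob L t x y)"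
    using S by (simp add: subset_iff)
  then show ?thesis
    using sum_trans_prob[OF finite_subset[OF S finite_\<Omega>]] by (simp add: gen_eq)
qed

lemma prob_space_law_at:
  "markov_chain \<Omega> L x M X \<Longrightarrow> 0 \<le> t \<Longrightarrow> prob_space (law_at \<Omega> M X t)"
  unfolding law_at_def markov_chain_def by (auto intro: prob_space.prob_space_distr)

lemma tv_dist_leI:
  assumes "\<And>S. S \<subseteq> \<Omega> \<Longrightarrow> \<bar>measure \<mu> S - measure \<nu> S\<bar> \<le> b"
  shows "tv_dist \<Omega> \<mu> \<nu> \<le> b"
  unfolding tv_dist_def using finite_\<Omega> assms by (subst Max_le_iff) auto

lemma tv_dist_law_at_le:
  assumes M: "markov_chain \<Omega> L x M X" "markov_chain \<Omega> L y N Y" and t: "0 \<le> t"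
    and xy: "x \<in> \<Omega>" "y \<in> \<Omega>"
  shows "tv_dist \<Omega> (law_at \<Omega> M X t) (law_at \<Omega> N Y t)
    \<le> min (2 * real (card V) * exp (- rate * t)) 1"
proof (rule tv_dist_leI)
  fix S assume S: "S \<subseteq> \<Omega>"
  interpret P: prob_space "law_at \<Omega> M X t" using M(1) t by (rule prob_space_law_at)
  interpret Q: prob_space "law_at \<Omega> N Y t" using M(2) t by (rule prob_space_law_at)
  have "\<bar>P.prob S - Q.prob S\<bar> \<le> 1"
    using P.prob_le_1[of S] Q.prob_le_1[of S] measure_nonneg[of "law_at \<Omega> M X t" S]
      measure_nonneg[of "law_at \<Omega> N Y t" S] by linarith
  then show "\<bar>P.prob S - Q.prob S\<bar> \<le> min (2 * real (card V) * exp (- rate * t)) 1"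
    using semigroup_indicator_diff[OF t xy] M by (simp add: law_at_eq[OF _ t S] xy)
qed

text \<open>By invariance, the mass that \<pi> gives to S is the \<pi>-average over z of the
  semigroup value at z. As the weights sum to 1, the difference from the value at x is an average of
  differences already bounded by \<open>semigroup_indicator_diff\<close>.\<close>

lemma tv_dist_equilibrium_le:
  assumes M: "markov_chain \<Omega> L x M X" and t: "0 \<le> t" and x: "x \<in> \<Omega>" and \<pi>: "equilibrium \<Omega> L \<pi>"
  shows "tv_dist \<Omega> (law_at \<Omega> M X t) (measure_pmf \<pi>) \<le> 2 * real (card V) * exp (- rate * t)"
proof (rule tv_dist_leI)
  fix S assume S: "S \<subseteq> \<Omega>"
  let ?P = "semigroup_of L t (indicator S)" and ?b = "2 * real (card V) * exp (- rate * t)"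
  have fS: "finite S" using S finite_\<Omega> by (rule finite_subset)
  have mass: "(\<Sum>z\<in>\<Omega>. pmf \<pi> z) = 1"
    using \<pi> finite_\<Omega> by (intro sum_pmf_eq_1) (auto simp: equilibrium_def)
  have "measure_pmf.prob \<pi> S = (\<Sum>y\<in>S. \<Sum>z\<in>\<Omega>. pmf \<pi> z * trans_prob L t z y)"
    using \<pi> t S by (subst measure_measure_pmf_finite[OF fS], intro sum.cong) (auto simp: equilibrium_def)
  also have "\<dots> = (\<Sum>z\<in>\<Omega>. pmf \<pi> z * ?P z)"
    using sum_trans_prob[OF fS] by (subst sum.swap) (simp add: gen_eq sum_distrib_left[symmetric])
  finally have "\<bar>?P x - measure_pmf.prob \<pi> S\<bar> = \<bar>\<Sum>z\<in>\<Omega>. pmf \<pi> z * (?P x - ?P z)\<bar>"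
    by (simp add: right_diff_distrib sum_subtractf sum_distrib_right[symmetric] mass)
  also have "\<dots> \<le> (\<Sum>z\<in>\<Omega>. pmf \<pi> z * ?b)"
  proof (rule order_trans[OF sum_abs sum_mono])
    fix z assume "z \<in> \<Omega>"
    then show "\<bar>pmf \<pi> z * (?P x - ?P z)\<bar> \<le> pmf \<pi> z * ?b"
      using semigroup_indicator_diff[OF t x, of z S]
      by (simp only: abs_mult abs_of_nonneg[OF pmf_nonneg] mult_left_mono pmf_nonneg)
  qed
  also have "\<dots> = ?b" by (simp only: sum_distrib_right[symmetric] mass mult_1)
  finally show "\<bar>measure (law_at \<Omega> M X t) S - measure_pmf.prob \<pi> S\<bar> \<le> ?b"
    using M by (simp add: law_at_eq[OF _ t S x])
qed

lemma \<Omega>_nonempty: "\<Omega> \<noteq> {}"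
proof -
  have "(\<lambda>v\<in>V. 0) \<in> \<Omega>" by (auto simp: configs_def)
  then show ?thesis by auto
qed

text \<open>The time \<open>?t\<close> solves 2n * exp (- rate * t) = \<epsilon>, so it belongs to
  the set whose infimum is the mixing time.\<close>

lemma mixing_time_le:
  assumes M: "\<And>x. x \<in> \<Omega> \<Longrightarrow> markov_chain \<Omega> L x (PX x) X" and \<pi>: "equilibrium \<Omega> L \<pi>"
    and \<epsilon>: "0 < \<epsilon>" "\<epsilon> < 1"
  shows "mixing_time \<Omega> (\<lambda>t x. law_at \<Omega> (PX x) X t) \<pi> \<epsilon> \<le> ereal (ln (2 * real (card V) / \<epsilon>) / rate)"
proof -
  let ?n = "real (card V)" let ?t = "ln (2 * ?n / \<epsilon>) / rate"
  have n: "1 \<le> ?n" using finite_V V_nonempty by (simp add: Suc_le_eq card_gt_0_iff)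
  have r: "0 < rate" using avg_degree_pos min_deg by simp
  \<comment> \<open>The logarithm is nonnegative because 2n is at least 1 and \<epsilon> is below
    1.\<close>
  have t: "0 \<le> ?t" using n \<epsilon> r by (intro divide_nonneg_pos ln_ge_zero) (auto simp: field_simps)
  have "rate * ?t = ln (2 * ?n / \<epsilon>)"
    using r by (metis less_irrefl nonzero_mult_div_cancel_left times_divide_eq_right)
  then have "- rate * ?t = - ln (2 * ?n / \<epsilon>)" by (simp only: mult_minus_left)
  then have "exp (- rate * ?t) = inverse (exp (ln (2 * ?n / \<epsilon>)))" by (simp only: exp_minus)
  then have e: "2 * ?n * exp (- rate * ?t) = \<epsilon>" using n \<epsilon> by (simp add: field_simps)
  have "Max ((\<lambda>x. tv_dist \<Omega> (law_at \<Omega> (PX x) X ?t) (measure_pmf \<pi>)) ` \<Omega>) \<le> \<epsilon>"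
  proof (subst Max_le_iff, goal_cases)
    case 3
    show ?case using tv_dist_equilibrium_le[OF M t _ \<pi>] by (auto simp only: e)
  qed (use finite_\<Omega> \<Omega>_nonempty in auto)
  with t show ?thesis unfolding mixing_time_def by (intro Inf_lower imageI) simp
qed

end

theorem corollary1:
  fixes V :: "'a set" and E :: "'a set set" and K :: nat
    and lam p :: "'a \<Rightarrow> real"
    and PX :: "('a \<Rightarrow> nat) \<Rightarrow> 'm measure" and X :: "real \<Rightarrow> 'm \<Rightarrow> 'a \<Rightarrow> nat"
    and PY :: "('a \<Rightarrow> nat) \<Rightarrow> 'l measure" and Y :: "real \<Rightarrow> 'l \<Rightarrow> 'a \<Rightarrow> nat"
    and \<pi> :: "('a \<Rightarrow> nat) pmf"
  defines "\<Omega> \<equiv> configs V E K"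
    and "n \<equiv> real (card V)"
    and "dbar \<equiv> avg_degree V E"
    and "\<delta> \<equiv> real (min_degree V E)"
    and "L \<equiv> mch_generator V E K lam p"
  assumes "simple_graph V E"
    and "min_degree V E \<ge> 1"
    and "K \<ge> 1"
    and "\<And>v. v \<in> V \<Longrightarrow> 0 \<le> p v \<and> p v \<le> 1"
    and "\<And>v. v \<in> V \<Longrightarrow> lam v = real (vertex_degree V E v) / dbar"
    and "\<And>v. v \<in> V \<Longrightarrow> p v \<le> 2 / 3 * real K / real (vertex_degree V E v)"
    and "\<And>x. x \<in> \<Omega> \<Longrightarrow> markov_chain \<Omega> L x (PX x) X"
    and "\<And>y. y \<in> \<Omega> \<Longrightarrow> markov_chain \<Omega> L y (PY y) Y"
    and "equilibrium \<Omega> L \<pi>"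
  shows "(\<forall>t\<ge>0. Max ((\<lambda>(x, y). tv_dist \<Omega> (law_at \<Omega> (PX x) X t) (law_at \<Omega> (PY y) Y t)) ` (\<Omega> \<times> \<Omega>))
            \<le> min (2 * n * exp (- (\<delta> / dbar) * t / 3)) 1)
       \<and> (\<forall>\<epsilon>. 0 < \<epsilon> \<and> \<epsilon> < 1 \<longrightarrow>
            mixing_time \<Omega> (\<lambda>t x. law_at \<Omega> (PX x) X t) \<pi> \<epsilon>
              \<le> ereal (3 * (dbar / \<delta>) * ln (2 * n / \<epsilon>)))"
proof -
  interpret mch_chain V E K lam p
    using assms(6-11) unfolding dbar_def by unfold_locales auto
  have rate: "- (\<delta> / dbar) * t / 3 = - rate * t" for t
    by (simp add: \<delta>_def dbar_def)
  have time: "ln (2 * n / \<epsilon>) / rate = 3 * (dbar / \<delta>) * ln (2 * n / \<epsilon>)" for \<epsilon>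
    by (simp add: \<delta>_def dbar_def)
  show ?thesis
  proof (intro conjI allI impI)
    fix t :: real assume t: "0 \<le> t"
    show "Max ((\<lambda>(x, y). tv_dist \<Omega> (law_at \<Omega> (PX x) X t) (law_at \<Omega> (PY y) Y t)) ` (\<Omega> \<times> \<Omega>))
        \<le> min (2 * n * exp (- (\<delta> / dbar) * t / 3)) 1"
    proof (rule Max.boundedI)
      fix b assume "b \<in> (\<lambda>(x, y). tv_dist \<Omega> (law_at \<Omega> (PX x) X t) (law_at \<Omega> (PY y) Y t)) ` (\<Omega> \<times> \<Omega>)"
      then obtain x y where xy: "x \<in> \<Omega>" "y \<in> \<Omega>"
        and b: "b = tv_dist \<Omega> (law_at \<Omega> (PX x) X t) (law_at \<Omega> (PY y) Y t)" by auto
      show "b \<le> min (2 * n * exp (- (\<delta> / dbar) * t / 3)) 1"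
        unfolding b rate using tv_dist_law_at_le[OF _ _ t] xy assms(12)[OF xy(1)] assms(13)[OF xy(2)]
        unfolding \<Omega>_def L_def n_def by blast
    qed (use finite_\<Omega> \<Omega>_nonempty in \<open>simp_all add: \<Omega>_def\<close>)
  next
    fix \<epsilon> :: real assume "0 < \<epsilon> \<and> \<epsilon> < 1"
    then show "mixing_time \<Omega> (\<lambda>t x. law_at \<Omega> (PX x) X t) \<pi> \<epsilon>
        \<le> ereal (3 * (dbar / \<delta>) * ln (2 * n / \<epsilon>))"
      using assms(12,14) unfolding time[symmetric] unfolding \<Omega>_def L_def n_def
      by (intro mixing_time_le) auto
  qed
qed

end
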